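(* Let $n\ge 1$ be an integer and let $T$ be a tree with $n$ vertices. Then $$\mathscr{D}_1(T)=1 \quad\text{and}\quad \mathscr{D}_2(T)=1-(n \bmod 2),$$ where $n \bmod 2\in\{0,1\}$ is the remainder of $n$ on division by $2$.
   Context: All graphs are finite and simple. For a graph $G$ and a labelling $f: V(G)\to\{0,1\}$, the induced edge labelling is $\overline{f}(xy)=|f(x)-f(y)|$ for $xy\in E(G)$. For $i\in\{0,1\}$, $v_i(f)$ is the number of vertices with label $i$ and $e_i(f)$ is the number of edges with induced label $i$. Put $\Delta_v(f)=|v_0(f)-v_1(f)|$ and $\Delta_e(f)=|e_0(f)-e_1(f)|$. Define $$\mathscr{D}_1(G)=\min_{f}\{\Delta_v(f)+\Delta_e(f)\},\qquad \mathscr{D}_2(G)=\min_{f:\,\Delta_v(f)\le 1}\{\Delta_e(f)\},$$ where the first minimum is over all labellings $f:V(G)\to\{0,1\}$ and the second is over those with $\Delta_v(f)\le 1$. *)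

theory Defs
  imports "Graph_Theory.Digraph_Component" "HOL-Library.FuncSet"
begin

text \<open>
  A finite simple graph is a \<^locale>\<open>pair_graph\<close>: a finite, symmetric, loop-free
  set of pairs on a finite vertex set. Every undirected edge is thus represented by two
  opposite arcs, so edges are counted as two-element sets.
\<close>

definition uedges :: "'a pair_pre_digraph \<Rightarrow> 'a set set" where
  "uedges G = {{x, y} | x y. (x, y) \<in> parcs G}"

text \<open>
  The predicate \<^const>\<open>tree\<close> of Graph\_Theory is not the undirected notion: it regards the
  closed walk along an arc and back along its reverse as a cycle, so that no symmetric graph with
  an edge satisfies it. In a simple graph the cycles are the directed cycles of length at least 3.
\<close>

definition simple_tree :: "'a pair_pre_digraph \<Rightarrow> bool" where
  "simple_tree G \<longleftrightarrow>
     pair_graph G \<and> connected (with_proj G) \<and>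
     \<not> (\<exists>p. pre_digraph.cycle (with_proj G) p \<and> length p \<ge> 3)"

text \<open>
  Labels are integers so that differences do not truncate. The extensional function space
  makes the labellings of a finite graph a finite set.
\<close>

definition labellings :: "'a pair_pre_digraph \<Rightarrow> ('a \<Rightarrow> int) set" where
  "labellings G = pverts G \<rightarrow>\<^sub>E {0, 1}"

definition v_count :: "'a pair_pre_digraph \<Rightarrow> ('a \<Rightarrow> int) \<Rightarrow> int \<Rightarrow> nat" where
  "v_count G f i = card {x \<in> pverts G. f x = i}"

definition e_count :: "'a pair_pre_digraph \<Rightarrow> ('a \<Rightarrow> int) \<Rightarrow> int \<Rightarrow> nat" where
  "e_count G f i = card {{x, y} | x y. {x, y} \<in> uedges G \<and> \<bar>f x - f y\<bar> = i}"

definition Delta_v :: "'a pair_pre_digraph \<Rightarrow> ('a \<Rightarrow> int) \<Rightarrow> int" where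
  "Delta_v G f = \<bar>int (v_count G f 0) - int (v_count G f 1)\<bar>"

definition Delta_e :: "'a pair_pre_digraph \<Rightarrow> ('a \<Rightarrow> int) \<Rightarrow> int" where
  "Delta_e G f = \<bar>int (e_count G f 0) - int (e_count G f 1)\<bar>"

definition D1 :: "'a pair_pre_digraph \<Rightarrow> int" where
  "D1 G = Min ((\<lambda>f. Delta_v G f + Delta_e G f) ` labellings G)"

definition D2 :: "'a pair_pre_digraph \<Rightarrow> int" where
  "D2 G = Min (Delta_e G ` {f \<in> labellings G. Delta_v G f \<le> 1})"

text \<open>For a finite graph both minima range over finite nonempty sets.\<close>

lemma finite_labellings: "finite (pverts G) \<Longrightarrow> finite (labellings G)"
  unfolding labellings_def by (intro finite_PiE) auto

lemma balanced_labelling_exists: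
  assumes "finite (pverts G)"
  shows "\<exists>f \<in> labellings G. Delta_v G f \<le> 1"
proof -
  obtain A where A: "A \<subseteq> pverts G" "card A = card (pverts G) div 2"
    by (meson obtain_subset_with_card_n div_le_dividend)
  define f :: "'a \<Rightarrow> int" where "f = (\<lambda>x \<in> pverts G. if x \<in> A then 1 else 0)"
  have "{x \<in> pverts G. f x = 1} = A" "{x \<in> pverts G. f x = 0} = pverts G - A"
    using A(1) by (auto simp: f_def)
  then have "v_count G f 1 = card A" "v_count G f 0 = card (pverts G) - card A"
    using assms A(1) by (simp_all add: v_count_def card_Diff_subset finite_subset)
  then have "Delta_v G f \<le> 1"
    using A(2) unfolding Delta_v_def by linarith
  moreover have "f \<in> labellings G"
    by (auto simp: labellings_def f_def)
  ultimately show ?thesis by blast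
qed

end

theory Submission
  imports Defs
begin

text \<open>
  Replace the label \<open>f x \<in> {0, 1}\<close> by the sign \<open>1 - 2 * f x\<close>, and give an edge the product of the
  signs at its two ends. Then \<open>Delta_v\<close> and \<open>Delta_e\<close> become the absolute values of the sum of the
  vertex signs and of the sum of the edge signs.

  \<^emph>\<open>Lower bounds.\<close> A sum of \<open>k\<close> signs has the parity of \<open>k\<close>. A tree with \<open>n\<close> vertices has
  \<open>n - 1\<close> edges, so exactly one of the two sums is odd: the vertex sum if \<open>n\<close> is odd, the edge sum
  if \<open>n\<close> is even.

  \<^emph>\<open>Upper bounds.\<close> By induction a tree has a sign assignment for which one of the two sums is
  \<open>0\<close> and the other is \<open>1\<close> or \<open>-1\<close> (lemma \<open>leaf_built_cordial\<close>). When a leaf is attached, exactly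
  one new vertex sign and one new edge sign appear, and either of them can be prescribed by the
  sign of the leaf. It is chosen so as to cancel the sum that was \<open>1\<close> or \<open>-1\<close>; the sum
  that was \<open>0\<close> becomes \<open>1\<close> or \<open>-1\<close>. By parity a single assignment of this kind attains
  both minima.

  The induction needs every tree to arise from a single vertex by attaching leaves
  (lemma \<open>simple_tree_leaf_built\<close>). A vertex set that has been reached in this way and
  is not yet everything has an edge leaving it, because the tree is connected; the new endpoint of
  that edge has only one neighbour in the set, because a second one would close a cycle.
\<close>

section \<open>Trees grown by attaching leaves\<close>

inductive leaf_built :: "'a set \<Rightarrow> 'a set set \<Rightarrow> bool" where
  single: "leaf_built {v} {}"
| leaf: "leaf_built V E \<Longrightarrow> x \<in> V \<Longrightarrow> y \<notin> V \<Longrightarrow> leaf_built (insert y V) (insert {x, y} E)"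

lemma leaf_built_finite: "leaf_built V E \<Longrightarrow> finite V \<and> finite E"
  by (induction rule: leaf_built.induct) auto

lemma leaf_built_edges_within: "leaf_built V E \<Longrightarrow> e \<in> E \<Longrightarrow> e \<subseteq> V"
  by (induction rule: leaf_built.induct) auto

lemma leaf_built_new_edge: "leaf_built V E \<Longrightarrow> y \<notin> V \<Longrightarrow> {x, y} \<notin> E"
  using leaf_built_edges_within by fastforce

lemma leaf_built_card: "leaf_built V E \<Longrightarrow> card V = Suc (card E)"
  by (induction rule: leaf_built.induct)
    (auto simp: leaf_built_finite leaf_built_new_edge)

lemma (in pair_graph) doubleton_in_uedges: "{x, y} \<in> uedges G \<longleftrightarrow> (x, y) \<in> parcs G"
  by (auto simp: uedges_def doubleton_eq_iff intro: arcs_symmetric)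

text \<open>
  The path has to stay inside \<open>V\<close>: only then is it still a path when it is closed up
  through a vertex outside \<open>V\<close>.
\<close>

lemma (in pair_graph) leaf_built_apath:
  assumes "leaf_built V E" "E \<subseteq> uedges G" "V \<subseteq> pverts G" "a \<in> V" "b \<in> V"
  shows "\<exists>q. apath a q b \<and> set (pawalk_verts a q) \<subseteq> V"
  using assms
proof (induction arbitrary: a b rule: leaf_built.induct)
  case (single v)
  then have "apath a [] b \<and> set (pawalk_verts a []) \<subseteq> {v}"
    by (auto simp: apath_Nil_iff)
  then show ?case ..
next
  case (leaf V E x y)
  have arc: "(y, x) \<in> parcs G"
    using leaf.prems(1) doubleton_in_uedges[of y x] by (auto simp: insert_commute)
  have IH: "\<exists>q. apath a q b \<and> set (pawalk_verts a q) \<subseteq> V" if "a \<in> V" "b \<in> V" for a b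
    using leaf.IH leaf.prems that by auto
  have new: "\<exists>q. apath y q b \<and> set (pawalk_verts y q) \<subseteq> insert y V" if b: "b \<in> V" for b
  proof -
    obtain q where "apath x q b" "set (pawalk_verts x q) \<subseteq> V"
      using IH[OF \<open>x \<in> V\<close> b] by blast
    then have "apath y ((y, x) # q) b" "set (pawalk_verts y ((y, x) # q)) \<subseteq> insert y V"
      using arc \<open>y \<notin> V\<close> by (auto simp: apath_Cons_iff)
    then show ?thesis by blast
  qed
  consider "a \<in> V" "b \<in> V" | "a = y" "b \<in> V" | "a \<in> V" "b = y" | "a = y" "b = y"
    using leaf.prems by blast
  then show ?case
  proof cases
    case 1
    then show ?thesis using IH by blast
  next
    case 2
    then show ?thesis using new by blast
  next
    case 3
    then obtain q where q: "apath y q a" "set (pawalk_verts y q) \<subseteq> insert y V"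
      using new by blast
    then have "pawalk_verts a (rev_path q) = rev (pawalk_verts y q)"
      by (intro awalk_verts_rev_path awalkI_apath)
    then have "apath a (rev_path q) b \<and> set (pawalk_verts a (rev_path q)) \<subseteq> insert y V"
      using q 3 by simp
    then show ?thesis ..
  next
    case 4
    then have "apath a [] b \<and> set (pawalk_verts a []) \<subseteq> insert y V"
      using leaf.prems by (auto simp: apath_Nil_iff)
    then show ?thesis ..
  qed
qed

text \<open>
  Two distinct neighbours of \<open>y\<close> rule out the degenerate closed walk along an edge and back,
  which has length 2.
\<close>

lemma (in pair_graph) cycle_through_outside_vertex:
  assumes "apath x q x'" "x \<noteq> x'" "y \<notin> set (pawalk_verts x q)"
    and "(y, x) \<in> parcs G" "(x', y) \<in> parcs G"
  shows "\<exists>p. cycle p \<and> length p \<ge> 3"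
proof -
  define p where "p = (y, x) # q @ [(x', y)]"
  have walk: "awalk x q x'" and dist: "distinct (pawalk_verts x q)"
    using assms(1) by (auto simp: apath_def)
  have last: "awalk x' [(x', y)] y"
    using assms(5) by (auto simp: awalk_simps dest: in_arcsD2)
  have "awalk y p y"
    unfolding p_def awalk_Cons_iff using awalk_appendI[OF walk last] assms(4)
    by (simp del: awalk_append_iff)
  moreover have "pawalk_verts x (q @ [(x', y)]) = pawalk_verts x q @ [y]"
    using awalk_verts_append[OF awalk_appendI[OF walk last]] walk by simp
  then have "distinct (tl (pawalk_verts y p))"
    using dist assms(3) by (simp add: p_def)
  moreover have "q \<noteq> []"
    using assms(1,2) by (auto simp: apath_Nil_iff)
  then have "length p \<ge> 3"
    by (cases q) (auto simp: p_def)
  ultimately show ?thesis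
    unfolding cycle_def by (metis list.size(3) not_numeral_le_zero)
qed

lemma (in pair_graph) crossing_arc:
  assumes "connected (with_proj G)" "W \<subset> pverts G" "W \<noteq> {}"
  shows "\<exists>x y. x \<in> W \<and> y \<notin> W \<and> (x, y) \<in> parcs G"
proof (rule ccontr)
  assume closed: "\<not> ?thesis"
  obtain u v where uv: "u \<in> W" "v \<in> pverts G" "v \<notin> W"
    using assms by blast
  have "u \<rightarrow>\<^sup>*\<^bsub>with_proj G\<^esub> v"
    using symmetric_connected_imp_strongly_connected[OF pair_sym_arcs assms(1)] uv assms(2)
    by (auto simp: strongly_connected_def)
  then have "v \<in> W"
    by (induction rule: reachable_induct) (use uv(1) closed in auto)
  with uv(3) show False by simp
qed

text \<open>
  The set \<open>W\<close> carries all edges of the graph between its vertices, so that at \<open>k = card (pverts G)\<close> no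
  edge is left over. This survives the addition of a vertex because a connected \<open>W\<close> in an acyclic
  graph contains at most one neighbour of any vertex outside it.
\<close>

lemma (in pair_graph) acyclic_connected_leaf_built_subset:
  assumes conn: "connected (with_proj G)"
    and acyc: "\<not> (\<exists>p. cycle p \<and> length p \<ge> 3)"
    and "1 \<le> k" "k \<le> card (pverts G)"
  shows "\<exists>W \<subseteq> pverts G. card W = k \<and> leaf_built W {e \<in> uedges G. e \<subseteq> W}"
  using assms(3,4)
proof (induction k rule: nat_induct_at_least)
  case base
  then obtain v where v: "v \<in> pverts G"
    by fastforce
  have "{e \<in> uedges G. e \<subseteq> {v}} = {}"
    by (auto simp: uedges_def dest: no_loops')
  then have "leaf_built {v} {e \<in> uedges G. e \<subseteq> {v}}"
    by (simp only: leaf_built.single)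
  then show ?case
    using v by (intro exI[of _ "{v}"]) simp
next
  case (Suc k)
  then obtain W where W: "W \<subseteq> pverts G" "card W = k" "leaf_built W {e \<in> uedges G. e \<subseteq> W}"
    by auto
  have "W \<noteq> {}" "W \<subset> pverts G"
    using W Suc by auto
  then obtain x y where xy: "x \<in> W" "y \<notin> W" "(x, y) \<in> parcs G"
    using crossing_arc[OF conn] by blast
  have unique: "z = x" if z: "z \<in> W" "(z, y) \<in> parcs G" for z
  proof (rule ccontr)
    assume "z \<noteq> x"
    obtain q where q: "apath x q z" "set (pawalk_verts x q) \<subseteq> W"
      using leaf_built_apath[OF W(3) _ W(1) xy(1) z(1)] by blast
    have "(y, x) \<in> parcs G"
      using xy(3) by (rule arcs_symmetric)
    with q \<open>z \<noteq> x\<close> xy(2) z(2) have "\<exists>p. cycle p \<and> length p \<ge> 3"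
      by (intro cycle_through_outside_vertex[of x q z y]) auto
    with acyc show False ..
  qed
  have "{e \<in> uedges G. e \<subseteq> insert y W} = insert {x, y} {e \<in> uedges G. e \<subseteq> W}"
  proof (intro equalityI subsetI)
    fix e assume e: "e \<in> {e \<in> uedges G. e \<subseteq> insert y W}"
    then obtain a b where ab: "e = {a, b}" "(a, b) \<in> parcs G" "(b, a) \<in> parcs G" "a \<noteq> b"
      by (auto simp: uedges_def dest: no_loops' arcs_symmetric)
    show "e \<in> insert {x, y} {e \<in> uedges G. e \<subseteq> W}"
    proof (cases "y \<in> e")
      case True
      then have "e = {x, y}"
        using ab e unique by auto
      then show ?thesis by simp
    next
      case False
      then show ?thesis using e by auto
    qed
  next
    fix e assume "e \<in> insert {x, y} {e \<in> uedges G. e \<subseteq> W}"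
    then show "e \<in> {e \<in> uedges G. e \<subseteq> insert y W}"
      using xy by (auto simp: doubleton_in_uedges)
  qed
  then have "leaf_built (insert y W) {e \<in> uedges G. e \<subseteq> insert y W}"
    using leaf_built.leaf[OF W(3) xy(1,2)] by simp
  moreover have "insert y W \<subseteq> pverts G"
    using W(1) xy(3) by (auto dest: in_arcsD2)
  moreover have "card (insert y W) = Suc k"
    using W(2) xy(2) leaf_built_finite[OF W(3)] by simp
  ultimately show ?case by blast
qed

lemma simple_tree_leaf_built:
  assumes "simple_tree T" "1 \<le> card (pverts T)"
  shows "leaf_built (pverts T) (uedges T)"
proof -
  interpret pair_graph T
    using assms(1) by (simp add: simple_tree_def)
  obtain W where W: "W \<subseteq> pverts T" "card W = card (pverts T)"
      "leaf_built W {e \<in> uedges T. e \<subseteq> W}"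
    using acyclic_connected_leaf_built_subset[of "card (pverts T)"] assms
    by (auto simp: simple_tree_def)
  then have "W = pverts T"
    using pair_finite_verts by (metis card_subset_eq)
  moreover have "{e \<in> uedges T. e \<subseteq> pverts T} = uedges T"
    by (auto simp: uedges_def dest: in_arcsD1 in_arcsD2)
  ultimately show ?thesis using W(3) by simp
qed

section \<open>Sums of signs\<close>

lemma even_sum_signs_iff:
  fixes g :: "'b \<Rightarrow> int"
  assumes "finite A" "\<And>x. x \<in> A \<Longrightarrow> g x \<in> {1, -1}"
  shows "even (sum g A) \<longleftrightarrow> even (card A)"
  using assms
proof (induction A rule: finite_induct)
  case (insert x A)
  have "g x \<in> {1, -1}"
    by (rule insert.prems) simp
  then have "odd (g x)"
    by auto
  moreover have "even (sum g A) \<longleftrightarrow> even (card A)"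
    by (rule insert.IH) (rule insert.prems, simp)
  ultimately show ?case
    using insert.hyps by simp
qed simp

lemma sum_signs_eq_card_diff:
  assumes "finite A"
  shows "(\<Sum>x\<in>A. if P x then 1 else -1) = int (card {x \<in> A. P x}) - int (card {x \<in> A. \<not> P x})"
  using assms by (simp add: sum.If_cases Int_def Compl_eq)

definition sign_excess :: "('a \<Rightarrow> int) \<Rightarrow> 'a set set \<Rightarrow> int" where
  "sign_excess s E = (\<Sum>e\<in>E. \<Prod>x\<in>e. s x)"

text \<open>
  If the vertex sum is \<open>0\<close>, the sign \<open>c\<close> of the new leaf makes the new edge sign \<open>c * s x\<close> cancel
  the edge sum; otherwise the edge sum is \<open>0\<close> and \<open>c\<close> itself cancels the vertex sum.
\<close>

lemma leaf_built_cordial: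
  assumes "leaf_built V E"
  shows "\<exists>s. range s \<subseteq> {1, -1} \<and> \<bar>sum s V\<bar> + \<bar>sign_excess s E\<bar> = 1"
  using assms
proof (induction rule: leaf_built.induct)
  case (single v)
  show ?case by (rule exI[of _ "\<lambda>_. 1"]) (simp add: sign_excess_def)
next
  case (leaf V E x y)
  then obtain s where s: "range s \<subseteq> {1, -1}" "\<bar>sum s V\<bar> + \<bar>sign_excess s E\<bar> = 1"
    by blast
  have sx: "s x = 1 \<or> s x = -1"
    using s(1) by auto
  define c where "c = (if sum s V = 0 then - (sign_excess s E * s x) else - sum s V)"
  have c: "c = 1 \<or> c = -1"
    using s(2) sx by (auto simp: c_def abs_if split: if_splits)
  have fin: "finite V" "finite E"
    using leaf_built_finite[OF leaf.hyps(1)] by auto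
  have "sum (s(y := c)) V = sum s V"
    using leaf.hyps(3) by (intro sum.cong) auto
  then have vsum: "sum (s(y := c)) (insert y V) = c + sum s V"
    using fin leaf.hyps(3) by simp
  have "sign_excess (s(y := c)) E = sign_excess s E"
    unfolding sign_excess_def using leaf_built_edges_within[OF leaf.hyps(1)] leaf.hyps(3)
    by (intro sum.cong prod.cong) auto
  moreover have "x \<noteq> y"
    using leaf.hyps by blast
  ultimately have esum: "sign_excess (s(y := c)) (insert {x, y} E) = s x * c + sign_excess s E"
    using fin leaf_built_new_edge[OF leaf.hyps(1,3), of x] by (simp add: sign_excess_def)
  have "\<bar>c + sum s V\<bar> + \<bar>s x * c + sign_excess s E\<bar> = 1"
    using s(2) sx by (auto simp: c_def abs_if split: if_splits)
  then have "\<bar>sum (s(y := c)) (insert y V)\<bar> + \<bar>sign_excess (s(y := c)) (insert {x, y} E)\<bar> = 1"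
    unfolding vsum esum .
  moreover have "range (s(y := c)) \<subseteq> {1, -1}"
    using s(1) c by auto
  ultimately show ?case by blast
qed

section \<open>Labellings as signs\<close>

definition label_sign :: "('a \<Rightarrow> int) \<Rightarrow> 'a \<Rightarrow> int" where
  "label_sign f x = 1 - 2 * f x"

lemma label_sign_in: "f \<in> labellings G \<Longrightarrow> x \<in> pverts G \<Longrightarrow> label_sign f x \<in> {1, -1}"
  by (auto simp: labellings_def label_sign_def PiE_iff)

context pair_graph
begin

lemma Delta_v_eq_signs:
  assumes "f \<in> labellings G"
  shows "Delta_v G f = \<bar>sum (label_sign f) (pverts G)\<bar>"
proof -
  have f: "f x = 0 \<or> f x = 1" if "x \<in> pverts G" for x
    using assms that by (auto simp: labellings_def)
  have "sum (label_sign f) (pverts G) = (\<Sum>x\<in>pverts G. if f x = 0 then 1 else -1)"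
    using f by (intro sum.cong) (auto simp: label_sign_def)
  moreover have "{x \<in> pverts G. f x \<noteq> 0} = {x \<in> pverts G. f x = 1}"
    using f by auto
  ultimately show ?thesis
    using pair_finite_verts by (simp add: sum_signs_eq_card_diff Delta_v_def v_count_def)
qed

lemma finite_uedges: "finite (uedges G)"
proof -
  have "uedges G = (\<lambda>(x, y). {x, y}) ` parcs G"
    by (auto simp: uedges_def)
  then show ?thesis
    using pair_finite_arcs by simp
qed

lemma edge_sign_cases:
  assumes "f \<in> labellings G" "(x, y) \<in> parcs G"
  shows "(\<Prod>z\<in>{x, y}. label_sign f z) = 1 \<and> \<bar>f x - f y\<bar> = 0 \<or>
         (\<Prod>z\<in>{x, y}. label_sign f z) = -1 \<and> \<bar>f x - f y\<bar> = 1"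
proof -
  have "x \<noteq> y" "f x = 0 \<or> f x = 1" "f y = 0 \<or> f y = 1"
    using assms no_loops' in_arcsD1 in_arcsD2 by (auto simp: labellings_def)
  then show ?thesis
    by (auto simp: label_sign_def)
qed

lemma e_count_eq_signs:
  assumes "f \<in> labellings G"
  shows "e_count G f 0 = card {e \<in> uedges G. prod (label_sign f) e = 1}"
    and "e_count G f 1 = card {e \<in> uedges G. prod (label_sign f) e \<noteq> 1}"
proof -
  have "{{x, y} | x y. {x, y} \<in> uedges G \<and> \<bar>f x - f y\<bar> = i}
      = {e \<in> uedges G. (prod (label_sign f) e = 1) = (i = 0)}" if "i \<in> {0, 1}" for i
  proof (intro equalityI subsetI)
    fix e assume "e \<in> {{x, y} | x y. {x, y} \<in> uedges G \<and> \<bar>f x - f y\<bar> = i}"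
    then obtain x y where e: "e = {x, y}" "e \<in> uedges G" "\<bar>f x - f y\<bar> = i"
      by blast
    then have "(x, y) \<in> parcs G"
      by (simp add: doubleton_in_uedges)
    from edge_sign_cases[OF assms this] e show "e \<in> {e \<in> uedges G. (prod (label_sign f) e = 1) = (i = 0)}"
      by auto
  next
    fix e assume e: "e \<in> {e \<in> uedges G. (prod (label_sign f) e = 1) = (i = 0)}"
    then obtain x y where xy: "e = {x, y}" "(x, y) \<in> parcs G"
      by (auto simp: uedges_def)
    have "\<bar>f x - f y\<bar> = i"
      using edge_sign_cases[OF assms xy(2)] e \<open>i \<in> {0, 1}\<close> unfolding xy(1) by auto
    then show "e \<in> {{x, y} | x y. {x, y} \<in> uedges G \<and> \<bar>f x - f y\<bar> = i}"
      using e xy(1) by blast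
  qed
  from this[of 0] this[of 1] show "e_count G f 0 = card {e \<in> uedges G. prod (label_sign f) e = 1}"
    and "e_count G f 1 = card {e \<in> uedges G. prod (label_sign f) e \<noteq> 1}"
    by (simp_all add: e_count_def)
qed

lemma edge_sign_in:
  assumes "f \<in> labellings G" "e \<in> uedges G"
  shows "prod (label_sign f) e \<in> {1, -1}"
proof -
  obtain x y where "e = {x, y}" "(x, y) \<in> parcs G"
    using assms(2) by (auto simp: uedges_def)
  then show ?thesis
    using edge_sign_cases[OF assms(1)] by auto
qed

lemma Delta_e_eq_signs:
  assumes "f \<in> labellings G"
  shows "Delta_e G f = \<bar>sign_excess (label_sign f) (uedges G)\<bar>"
proof -
  have "sign_excess (label_sign f) (uedges G)
      = (\<Sum>e\<in>uedges G. if prod (label_sign f) e = 1 then 1 else -1)"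
    unfolding sign_excess_def using edge_sign_in[OF assms] by (intro sum.cong) auto
  then show ?thesis
    using finite_uedges
    by (simp add: sum_signs_eq_card_diff Delta_e_def e_count_eq_signs[OF assms])
qed

lemma even_Delta_v_iff:
  assumes "f \<in> labellings G"
  shows "even (Delta_v G f) \<longleftrightarrow> even (card (pverts G))"
  using even_sum_signs_iff[OF pair_finite_verts label_sign_in[OF assms]]
  by (simp add: Delta_v_eq_signs[OF assms])

lemma even_Delta_e_iff:
  assumes "f \<in> labellings G"
  shows "even (Delta_e G f) \<longleftrightarrow> even (card (uedges G))"
  using even_sum_signs_iff[OF finite_uedges edge_sign_in[OF assms]]
  by (simp add: Delta_e_eq_signs[OF assms] sign_excess_def)

lemma labelling_of_signs:
  assumes "range s \<subseteq> {1, -1}"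
  shows "\<exists>f \<in> labellings G. Delta_v G f = \<bar>sum s (pverts G)\<bar> \<and> Delta_e G f = \<bar>sign_excess s (uedges G)\<bar>"
proof
  define f where "f = (\<lambda>x\<in>pverts G. (1 - s x) div 2)"
  have s: "s x = 1 \<or> s x = -1" for x
    using assms by auto
  have sign: "label_sign f x = s x" if "x \<in> pverts G" for x
    using that s[of x] by (auto simp: f_def label_sign_def)
  have "(1 - s x) div 2 \<in> {0, 1}" for x
    using s[of x] by auto
  then show f: "f \<in> labellings G"
    by (auto simp: labellings_def f_def)
  have "sum (label_sign f) (pverts G) = sum s (pverts G)"
    using sign by (intro sum.cong) auto
  moreover have "sign_excess (label_sign f) (uedges G) = sign_excess s (uedges G)"
    unfolding sign_excess_def using sign
    by (intro sum.cong prod.cong) (auto simp: uedges_def dest: in_arcsD1 in_arcsD2)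
  ultimately show "Delta_v G f = \<bar>sum s (pverts G)\<bar> \<and> Delta_e G f = \<bar>sign_excess s (uedges G)\<bar>"
    by (simp add: Delta_v_eq_signs[OF f] Delta_e_eq_signs[OF f])
qed

end

section \<open>The two discrepancies of a tree\<close>

theorem theorem3p1:
  fixes T :: "'a pair_pre_digraph" and n :: nat
  assumes "n \<ge> 1"
    and "simple_tree T"
    and "card (pverts T) = n"
  shows "D1 T = 1 \<and> D2 T = 1 - int (n mod 2)"
proof -
  interpret pair_graph T
    using assms(2) by (simp add: simple_tree_def)
  have built: "leaf_built (pverts T) (uedges T)"
    using simple_tree_leaf_built assms by blast
  have edges: "n = Suc (card (uedges T))"
    using leaf_built_card[OF built] assms(3) by simp
  have fin: "finite (labellings T)"
    by (rule finite_labellings[OF pair_finite_verts])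
  have nonneg: "0 \<le> Delta_v T f" "0 \<le> Delta_e T f" for f
    by (simp_all add: Delta_v_def Delta_e_def)
  have par: "even (Delta_v T f) \<longleftrightarrow> even n" "even (Delta_e T f) \<longleftrightarrow> odd n"
    if "f \<in> labellings T" for f
    using even_Delta_v_iff[OF that] even_Delta_e_iff[OF that] assms(3) edges by auto
  obtain f where f: "f \<in> labellings T" "Delta_v T f + Delta_e T f = 1"
    using leaf_built_cordial[OF built] labelling_of_signs by metis
  have lower1: "1 \<le> Delta_v T g + Delta_e T g" if "g \<in> labellings T" for g
  proof -
    have "odd (Delta_v T g + Delta_e T g)"
      using par[OF that] by simp
    then have "Delta_v T g + Delta_e T g \<noteq> 0"
      by (metis even_zero)
    then show ?thesis
      using nonneg[of g] by linarith
  qed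
  have "D1 T = 1"
    unfolding D1_def
  proof (rule Min_eqI)
    show "finite ((\<lambda>f. Delta_v T f + Delta_e T f) ` labellings T)"
      using fin by simp
    show "1 \<le> d" if "d \<in> (\<lambda>f. Delta_v T f + Delta_e T f) ` labellings T" for d
      using that lower1 by auto
    show "1 \<in> (\<lambda>f. Delta_v T f + Delta_e T f) ` labellings T"
      using f by (intro image_eqI[of _ _ f]) auto
  qed
  moreover have lower2: "1 - int (n mod 2) \<le> Delta_e T g" if "g \<in> labellings T" for g
  proof (cases "even n")
    case True
    then have "Delta_e T g \<noteq> 0"
      using par(2)[OF that] by (metis even_zero)
    then show ?thesis
      using nonneg(2)[of g] by linarith
  next
    case False
    then show ?thesis
      using nonneg(2)[of g] by (simp add: odd_iff_mod_2_eq_one)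
  qed
  \<comment> \<open>The summands of \<open>Delta_v T f + Delta_e T f = 1\<close> are nonnegative, so parity determines them.\<close>
  have "Delta_e T f = 1 - int (n mod 2)"
  proof -
    have "Delta_e T f = 0 \<or> Delta_e T f = 1"
      using f(2) nonneg[of f] by linarith
    then show ?thesis
      using par(2)[OF f(1)] by (cases "even n") (auto simp: odd_iff_mod_2_eq_one)
  qed
  moreover have "Delta_v T f \<le> 1"
    using f(2) nonneg[of f] by linarith
  ultimately have "D2 T = 1 - int (n mod 2)"
    unfolding D2_def using fin f(1) lower2 by (intro Min_eqI) (auto intro!: image_eqI[of _ _ f])
  with \<open>D1 T = 1\<close> show ?thesis ..
qed

end
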